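(* Let $M$ be a symmetric positive definite $d\times d$ matrix and let $X$ be a random vector in $\mathbb R^d$ with finite, nonconstant support. For a Borel set $A\subseteq\mathbb R^d$ with $0<\mathbb P(X\in A)<1$ (defining the partition $A\mid A^c$) let $$\mathcal V(A):=\min_{a,b\in\mathbb R^d}\mathbb E\bigl[\|X-a\|_M^2\mathbf 1_{\{X\in A\}}+\|X-b\|_M^2\mathbf 1_{\{X\notin A\}}\bigr].$$ A global minimizer of $\mathcal V$ exists and may be chosen to be an affine halfspace. More precisely, let $A$ be a global minimizer and let $a=\mathbb E[X\mid X\in A]$ and $b=\mathbb E[X\mid X\notin A]$. Then $a\ne b$ and, up to the law of $X$ (i.e. modulo sets of probability zero under the law of $X$), $$\bigl\{x:\langle M(b-a),x-(a+b)/2\rangle<0\bigr\}\subseteq A\subseteq\bigl\{x:\langle M(b-a),x-(a+b)/2\rangle\le0\bigr\}.$$ Thus $A$ is (up to the law of $X$) a halfspace whenever the bisecting hyperplane $\{x:\langle M(b-a),x-(a+b)/2\rangle=0\}$ carries no mass; in general, only the points on that hyperplane may be allocated arbitrarily. Assigning all bisector mass to one side, while retaining two nonempty cells, produces a global halfspace minimizer. Its normal is $M(b-a)$.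
   Context: $\|x\|_M^2:=x^{\mathsf T}Mx$, and $\langle\cdot,\cdot\rangle$ denotes the standard Euclidean inner product on $\mathbb R^d$. *)

theory Defs
  imports "HOL-Probability.Probability"
begin

definition sym_pos_def :: "real^'n^'n \<Rightarrow> bool" where
  "sym_pos_def M \<longleftrightarrow> transpose M = M \<and> (\<forall>x. x \<noteq> 0 \<longrightarrow> 0 < x \<bullet> (M *v x))"

definition sqnorm_wrt :: "real^'n^'n \<Rightarrow> real^'n \<Rightarrow> real" where
  "sqnorm_wrt M x = x \<bullet> (M *v x)"

(* The topological support of the law of X; since the space is second countable,
   the law is carried by it. *)
definition law_support :: "'w measure \<Rightarrow> ('w \<Rightarrow> real^'n) \<Rightarrow> (real^'n) set" where
  "law_support P X = {x. \<forall>U. open U \<and> x \<in> U \<longrightarrow> 0 < \<P>(\<omega> in P. X \<omega> \<in> U)}"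

definition two_cell :: "'w measure \<Rightarrow> ('w \<Rightarrow> real^'n) \<Rightarrow> (real^'n) set \<Rightarrow> bool" where
  "two_cell P X A \<longleftrightarrow>
     A \<in> sets borel \<and> 0 < \<P>(\<omega> in P. X \<omega> \<in> A) \<and> \<P>(\<omega> in P. X \<omega> \<in> A) < 1"

definition cell_cost ::
  "'w measure \<Rightarrow> ('w \<Rightarrow> real^'n) \<Rightarrow> real^'n^'n \<Rightarrow> (real^'n) set \<Rightarrow> real^'n \<Rightarrow> real^'n \<Rightarrow> real" where
  "cell_cost P X M A a b =
     (LINT \<omega>|P. sqnorm_wrt M (X \<omega> - a) * indicator A (X \<omega>)
              + sqnorm_wrt M (X \<omega> - b) * indicator (- A) (X \<omega>))"

definition partition_value ::
  "'w measure \<Rightarrow> ('w \<Rightarrow> real^'n) \<Rightarrow> real^'n^'n \<Rightarrow> (real^'n) set \<Rightarrow> real" where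
  "partition_value P X M A = (INF (a, b) \<in> UNIV. cell_cost P X M A a b)"

definition global_minimizer ::
  "'w measure \<Rightarrow> ('w \<Rightarrow> real^'n) \<Rightarrow> real^'n^'n \<Rightarrow> (real^'n) set \<Rightarrow> bool" where
  "global_minimizer P X M A \<longleftrightarrow>
     two_cell P X A \<and>
     (\<forall>B. two_cell P X B \<longrightarrow> partition_value P X M A \<le> partition_value P X M B)"

(* Conditional expectation of X given the event that X lies in A, for an event of
   positive probability. *)
definition cond_mean :: "'w measure \<Rightarrow> ('w \<Rightarrow> real^'n) \<Rightarrow> (real^'n) set \<Rightarrow> real^'n" where
  "cond_mean P X A =
     (LINT \<omega>|P. indicator A (X \<omega>) *\<^sub>R X \<omega>) /\<^sub>R \<P>(\<omega> in P. X \<omega> \<in> A)"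

definition law_subset ::
  "'w measure \<Rightarrow> ('w \<Rightarrow> real^'n) \<Rightarrow> (real^'n) set \<Rightarrow> (real^'n) set \<Rightarrow> bool" where
  "law_subset P X A B \<longleftrightarrow> (AE x in distr P borel X. x \<in> A \<longrightarrow> x \<in> B)"

definition law_equal ::
  "'w measure \<Rightarrow> ('w \<Rightarrow> real^'n) \<Rightarrow> (real^'n) set \<Rightarrow> (real^'n) set \<Rightarrow> bool" where
  "law_equal P X A B \<longleftrightarrow> law_subset P X A B \<and> law_subset P X B A"

(* Halfspaces may be open or closed; v is the outward normal. *)
definition halfspace_with_normal :: "real^'n \<Rightarrow> (real^'n) set \<Rightarrow> bool" where
  "halfspace_with_normal v H \<longleftrightarrow>
     v \<noteq> 0 \<and> (\<exists>c. H = {x. v \<bullet> x < c} \<or> H = {x. v \<bullet> x \<le> c})"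

definition affine_halfspace :: "(real^'n) set \<Rightarrow> bool" where
  "affine_halfspace H \<longleftrightarrow> (\<exists>v. halfspace_with_normal v H)"

definition bisector_form :: "real^'n^'n \<Rightarrow> real^'n \<Rightarrow> real^'n \<Rightarrow> real^'n \<Rightarrow> real" where
  "bisector_form M a b x = (M *v (b - a)) \<bullet> (x - (a + b) /\<^sub>R 2)"

end

theory Submission
  imports Defs
begin

text \<open>
  The law of \<open>X\<close> is carried by its finite support, so every expectation is a finite weighted sum
  and \<open>\<V>(A)\<close> depends only on the points of the support in \<open>A\<close>; a minimizer therefore exists. For
  fixed \<open>A\<close> the optimal centres are the two cell means \<open>a\<close>, \<open>b\<close>. If \<open>a = b\<close>, isolating a support
  point different from \<open>a\<close> lowers the cost. Since
  \<open>\<parallel>x - a\<parallel>\<^sup>2 - \<parallel>x - b\<parallel>\<^sup>2 = 2 \<langle>M(b - a), x - (a + b)/2\<rangle>\<close>, moving a point on the wrong side of the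
  bisector lowers the cost with \<open>a\<close>, \<open>b\<close> held fixed, while reallocating bisector points leaves that
  cost unchanged. Both moves keep the cells nonempty because each mean lies strictly on its own side.
\<close>

section \<open>The quadratic form of \<open>M\<close> and the bisector function\<close>

lemma sym_pos_def_inner_commute:
  assumes "sym_pos_def M"
  shows "x \<bullet> (M *v y) = y \<bullet> (M *v x)"
proof -
  have "x \<bullet> (M *v y) = (x v* M) \<bullet> y"
    by (simp add: dot_lmul_matrix)
  also have "x v* M = M *v x"
    using assms unfolding sym_pos_def_def by (metis vector_transpose_matrix)
  finally show ?thesis
    by (simp add: inner_commute)
qed

lemma sqnorm_wrt_pos: "sym_pos_def M \<Longrightarrow> x \<noteq> 0 \<Longrightarrow> 0 < sqnorm_wrt M x"
  by (simp add: sym_pos_def_def sqnorm_wrt_def)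

lemma sqnorm_wrt_zero [simp]: "sqnorm_wrt M 0 = 0"
  by (simp add: sqnorm_wrt_def)

lemma sqnorm_wrt_nonneg: "sym_pos_def M \<Longrightarrow> 0 \<le> sqnorm_wrt M x"
  by (cases "x = 0") (auto dest: sqnorm_wrt_pos simp: less_imp_le)

lemma sqnorm_wrt_add:
  assumes "sym_pos_def M"
  shows "sqnorm_wrt M (x + y) = sqnorm_wrt M x + 2 * ((M *v y) \<bullet> x) + sqnorm_wrt M y"
  using sym_pos_def_inner_commute[OF assms, of x y]
  by (simp add: sqnorm_wrt_def matrix_vector_right_distrib inner_add_left inner_add_right inner_commute)

text \<open>The terms quadratic in \<open>x\<close> cancel and symmetry of \<open>M\<close> merges
  the cross terms, leaving an affine function of \<open>x\<close>. The sign of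
  \<open>bisector_form\<close> thus decides which of the two centres is nearer.\<close>

lemma sqnorm_wrt_diff_bisector:
  assumes "sym_pos_def M"
  shows "sqnorm_wrt M (x - a) - sqnorm_wrt M (x - b) = 2 * bisector_form M a b x"
  using sym_pos_def_inner_commute[OF assms, of x a] sym_pos_def_inner_commute[OF assms, of x b]
    sym_pos_def_inner_commute[OF assms, of a b]
  by (simp add: sqnorm_wrt_def bisector_form_def matrix_vector_mult_diff_distrib inner_diff_left
      inner_diff_right inner_add_right inner_commute) (simp add: field_simps)

text \<open>At \<open>x = a\<close> the identity above leaves minus the squared distance between the
  centres. This strict sign later keeps reallocated cells nonempty.\<close>

lemma bisector_form_left: "sym_pos_def M \<Longrightarrow> a \<noteq> b \<Longrightarrow> bisector_form M a b a < 0"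
  using sqnorm_wrt_diff_bisector[of M a a b] sqnorm_wrt_pos[of M "a - b"] by simp

lemma bisector_form_right: "sym_pos_def M \<Longrightarrow> a \<noteq> b \<Longrightarrow> 0 < bisector_form M a b b"
  using sqnorm_wrt_diff_bisector[of M b a b] sqnorm_wrt_pos[of M "b - a"] by simp

lemma bisector_form_affine:
  "bisector_form M a b x = (M *v (b - a)) \<bullet> x - (M *v (b - a)) \<bullet> ((a + b) /\<^sub>R 2)"
  by (simp only: bisector_form_def inner_diff_right)

lemma sqnorm_wrt_borel_measurable [measurable]:
  "(\<lambda>x. sqnorm_wrt M (x - a)) \<in> borel_measurable borel"
  unfolding sqnorm_wrt_def
  by (intro borel_measurable_continuous_onI continuous_intros
      matrix_vector_mult_linear_continuous_on [THEN continuous_on_compose2]) auto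

lemma bisector_form_borel_measurable [measurable]: "bisector_form M a b \<in> borel_measurable borel"
  unfolding bisector_form_def by measurable

lemma bisector_sublevel_halfspace:
  assumes "sym_pos_def M" "a \<noteq> b"
  shows "halfspace_with_normal (M *v (b - a)) {x. bisector_form M a b x < 0}"
    and "halfspace_with_normal (M *v (b - a)) {x. bisector_form M a b x \<le> 0}"
proof -
  have "M *v (b - a) \<noteq> 0"
    using assms sqnorm_wrt_pos[of M "b - a"] by (auto simp: sqnorm_wrt_def)
  then show "halfspace_with_normal (M *v (b - a)) {x. bisector_form M a b x < 0}"
    and "halfspace_with_normal (M *v (b - a)) {x. bisector_form M a b x \<le> 0}"
    by (auto simp: halfspace_with_normal_def bisector_form_affine
        intro!: exI[of _ "(M *v (b - a)) \<bullet> ((a + b) /\<^sub>R 2)"])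
qed

section \<open>The topological support of the law: full mass and atoms\<close>

lemma (in prob_space) AE_in_law_support:
  fixes X :: "'a \<Rightarrow> real^'n"
  assumes [measurable]: "X \<in> borel_measurable M"
  shows "AE \<omega> in M. X \<omega> \<in> law_support M X"
proof -
  define \<F> where "\<F> = {U :: (real^'n) set. open U \<and> prob {\<omega> \<in> space M. X \<omega> \<in> U} = 0}"
  \<comment> \<open>The complement of the support is the union of all null open sets. An uncountable
    union need not be null, so Lindelof extracts a countable subfamily with the same union.\<close>
  obtain \<G> where \<G>: "\<G> \<subseteq> \<F>" "countable \<G>" "\<Union>\<G> = \<Union>\<F>"
    using Lindelof[of \<F>] unfolding \<F>_def by blast
  have "AE \<omega> in M. X \<omega> \<notin> U" if "U \<in> \<G>" for U
  proof -
    from that \<G>(1) have U: "open U" "prob {\<omega> \<in> space M. X \<omega> \<in> U} = 0"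
      by (auto simp: \<F>_def)
    then have [measurable]: "U \<in> sets borel" by simp
    have "{\<omega> \<in> space M. X \<omega> \<in> U} \<in> events" by measurable
    then show ?thesis
      using U(2) by (simp add: AE_iff_measurable[OF _ refl] emeasure_eq_measure)
  qed
  then have "AE \<omega> in M. \<forall>U\<in>\<G>. X \<omega> \<notin> U"
    using \<G>(2) by (simp add: AE_ball_countable)
  moreover have "x \<in> law_support M X" if "\<forall>U\<in>\<G>. x \<notin> U" for x
    using that \<G>(3) unfolding law_support_def \<F>_def
    by (auto simp: zero_less_measure_iff)
  ultimately show ?thesis
    by (auto elim: AE_mp)
qed

text \<open>Deleting the finitely many other support points leaves an open neighbourhood of
  \<open>x\<close>. It has positive mass because \<open>x\<close> is in the support, and almost
  surely \<open>X\<close> meets it only at \<open>x\<close>.\<close>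

lemma (in prob_space) finite_law_support_atom:
  fixes X :: "'a \<Rightarrow> real^'n"
  assumes [measurable]: "X \<in> borel_measurable M" and "finite (law_support M X)" "x \<in> law_support M X"
  shows "0 < prob {\<omega> \<in> space M. X \<omega> = x}"
proof -
  let ?U = "- (law_support M X - {x})"
  have "open ?U" using assms(2) by (intro open_Compl finite_imp_closed) simp
  then have "0 < prob {\<omega> \<in> space M. X \<omega> \<in> ?U}"
    using assms(3) by (auto simp: law_support_def)
  also have "prob {\<omega> \<in> space M. X \<omega> \<in> ?U} = prob {\<omega> \<in> space M. X \<omega> = x}"
  proof (rule measure_eq_AE)
    show "AE \<omega> in M. \<omega> \<in> {\<omega> \<in> space M. X \<omega> \<in> ?U} \<longleftrightarrow> \<omega> \<in> {\<omega> \<in> space M. X \<omega> = x}"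
      using AE_in_law_support[OF assms(1)] by eventually_elim auto
    have [measurable]: "?U \<in> sets borel" using \<open>open ?U\<close> by simp
    show "{\<omega> \<in> space M. X \<omega> \<in> ?U} \<in> events" by measurable
  qed measurable
  finally show ?thesis .
qed

section \<open>Reduction of probabilities and expectations to sums over atoms\<close>

locale finitely_supported_vector = prob_space P for P :: "'w measure" +
  fixes X :: "'w \<Rightarrow> real^'n" and M :: "real^'n^'n" and S :: "(real^'n) set" and p :: "real^'n \<Rightarrow> real"
  defines "p \<equiv> \<lambda>x. prob {\<omega> \<in> space P. X \<omega> = x}"
  assumes X [measurable]: "X \<in> borel_measurable P"
    and M: "sym_pos_def M"
    and finite_S: "finite S"
    and AE_S: "AE \<omega> in P. X \<omega> \<in> S"
    and p_pos: "x \<in> S \<Longrightarrow> 0 < p x"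
    and not_singleton: "S \<noteq> {c}"
begin

text \<open>Almost surely exactly one of the indicators over \<open>S\<close> is nonzero, so
  \<open>f (X \<omega>)\<close> agrees with a finite combination of indicators, and linearity of the
  integral applies.\<close>

lemma expectation_eq_sum:
  fixes f :: "real^'n \<Rightarrow> 'b::{banach, second_countable_topology}"
  assumes [measurable]: "f \<in> borel_measurable borel"
  shows "(LINT \<omega>|P. f (X \<omega>)) = (\<Sum>x\<in>S. p x *\<^sub>R f x)"
proof -
  have "(LINT \<omega>|P. f (X \<omega>)) = (LINT \<omega>|P. (\<Sum>x\<in>S. indicator {\<omega> \<in> space P. X \<omega> = x} \<omega> *\<^sub>R f x))"
  proof (rule integral_cong_AE)
    show "AE \<omega> in P. f (X \<omega>) = (\<Sum>x\<in>S. indicator {\<omega> \<in> space P. X \<omega> = x} \<omega> *\<^sub>R f x)"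
      using AE_S AE_space
    proof eventually_elim
      case (elim \<omega>)
      have "(\<Sum>x\<in>S. indicator {\<omega> \<in> space P. X \<omega> = x} \<omega> *\<^sub>R f x)
          = (\<Sum>x\<in>S. if X \<omega> = x then f x else 0)"
        using elim by (intro sum.cong) (auto simp: indicator_def)
      then show ?case
        using elim finite_S by simp
    qed
  qed measurable
  also have "\<dots> = (\<Sum>x\<in>S. p x *\<^sub>R f x)"
    by (subst Bochner_Integration.integral_sum) (auto simp: p_def emeasure_eq_measure)
  finally show ?thesis .
qed

lemma prob_eq_sum:
  assumes [measurable]: "A \<in> sets borel"
  shows "\<P>(\<omega> in P. X \<omega> \<in> A) = (\<Sum>x\<in>S \<inter> A. p x)"
proof -
  have "\<P>(\<omega> in P. X \<omega> \<in> A) = (LINT \<omega>|P. indicator {\<omega> \<in> space P. X \<omega> \<in> A} \<omega>)"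
    by (simp add: Int_absorb2 subset_eq)
  also have "\<dots> = (LINT \<omega>|P. indicator A (X \<omega>))"
    by (intro Bochner_Integration.integral_cong) (auto simp: indicator_def)
  also have "\<dots> = (\<Sum>x\<in>S. p x *\<^sub>R indicator A x)"
    by (rule expectation_eq_sum) measurable
  also have "\<dots> = (\<Sum>x\<in>S \<inter> A. p x)"
    using finite_S by (simp add: indicator_def sum.inter_restrict if_distrib cong: if_cong)
  finally show ?thesis .
qed

lemma sum_p: "(\<Sum>x\<in>S. p x) = 1"
  using prob_eq_sum[of UNIV] prob_space by simp

lemma S_nonempty: "S \<noteq> {}"
  using sum_p by auto

lemma sum_p_pos:
  assumes "T \<subseteq> S" "T \<noteq> {}"
  shows "0 < (\<Sum>x\<in>T. p x)"
  using assms finite_S p_pos by (intro sum_pos) (auto intro: finite_subset)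

text \<open>Every point of \<open>S\<close> has positive weight, so the strict bounds on the
  probability become nonemptiness of the two traces on \<open>S\<close>.\<close>

lemma two_cell_iff: "two_cell P X A \<longleftrightarrow> A \<in> sets borel \<and> S \<inter> A \<noteq> {} \<and> S - A \<noteq> {}"
proof (cases "A \<in> sets borel")
  case True
  have "(\<Sum>x\<in>S \<inter> A. p x) + (\<Sum>x\<in>S - A. p x) = 1"
    using sum_p finite_S by (metis sum.Int_Diff)
  moreover have "0 < (\<Sum>x\<in>S \<inter> A. p x) \<longleftrightarrow> S \<inter> A \<noteq> {}"
    using sum_p_pos[of "S \<inter> A"] by auto
  moreover have "0 < (\<Sum>x\<in>S - A. p x) \<longleftrightarrow> S - A \<noteq> {}"
    using sum_p_pos[of "S - A"] by (metis Diff_subset less_irrefl sum.empty)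
  ultimately show ?thesis
    unfolding two_cell_def prob_eq_sum[OF True] using True by auto
qed (simp add: two_cell_def)

text \<open>A violation at a point of \<open>S\<close> would have positive probability, while points
  outside \<open>S\<close> are negligible. Inclusion up to the law is therefore pointwise inclusion
  on \<open>S\<close>.\<close>

lemma law_subset_iff: "law_subset P X A B \<longleftrightarrow> (\<forall>x\<in>S. x \<in> A \<longrightarrow> x \<in> B)"
proof
  assume "law_subset P X A B"
  then have *: "AE x in distr P borel X. x \<in> A \<longrightarrow> x \<in> B" by (simp add: law_subset_def)
  show "\<forall>x\<in>S. x \<in> A \<longrightarrow> x \<in> B"
  proof (rule ballI, rule ccontr)
    fix x assume x: "x \<in> S" "\<not> (x \<in> A \<longrightarrow> x \<in> B)"
    from * have "AE y in distr P borel X. y \<noteq> x"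
      by eventually_elim (use x in auto)
    then have "AE \<omega> in P. X \<omega> \<noteq> x"
      by (simp add: AE_distr_iff)
    then have "p x = 0"
      unfolding p_def by (subst prob_eq_0) auto
    with p_pos[OF x(1)] show False by simp
  qed
next
  assume R: "\<forall>x\<in>S. x \<in> A \<longrightarrow> x \<in> B"
  have "S \<in> sets borel" using finite_S by (simp add: finite_imp_closed)
  then have "AE x in distr P borel X. x \<in> S"
    using AE_S by (subst AE_distr_iff) auto
  then show "law_subset P X A B"
    unfolding law_subset_def by eventually_elim (use R in auto)
qed

lemma cell_cost_eq_sum:
  assumes [measurable]: "A \<in> sets borel"
  shows "cell_cost P X M A a b
    = (\<Sum>x\<in>S \<inter> A. p x * sqnorm_wrt M (x - a)) + (\<Sum>x\<in>S - A. p x * sqnorm_wrt M (x - b))"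
proof -
  have "cell_cost P X M A a b
    = (\<Sum>x\<in>S. p x *\<^sub>R (sqnorm_wrt M (x - a) * indicator A x + sqnorm_wrt M (x - b) * indicator (- A) x))"
    unfolding cell_cost_def by (rule expectation_eq_sum) measurable
  also have "\<dots> = (\<Sum>x\<in>S \<inter> A. p x * sqnorm_wrt M (x - a)) + (\<Sum>x\<in>S - A. p x * sqnorm_wrt M (x - b))"
    by (subst sum.Int_Diff[OF finite_S, of _ A]) simp
  finally show ?thesis .
qed

lemma cond_mean_eq_sum:
  assumes [measurable]: "A \<in> sets borel"
  shows "cond_mean P X A = (\<Sum>x\<in>S \<inter> A. p x *\<^sub>R x) /\<^sub>R (\<Sum>x\<in>S \<inter> A. p x)"
proof -
  have "(LINT \<omega>|P. indicator A (X \<omega>) *\<^sub>R X \<omega>) = (\<Sum>x\<in>S. p x *\<^sub>R (indicator A x *\<^sub>R x))"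
    by (rule expectation_eq_sum) measurable
  also have "\<dots> = (\<Sum>x\<in>S \<inter> A. p x *\<^sub>R x)"
    by (subst sum.Int_Diff[OF finite_S, of _ A]) simp
  finally show ?thesis
    by (simp add: cond_mean_def prob_eq_sum)
qed

section \<open>Cell means as optimal centres\<close>

lemma cond_mean_weighted:
  assumes "A \<in> sets borel" "S \<inter> A \<noteq> {}"
  shows "(\<Sum>x\<in>S \<inter> A. p x) *\<^sub>R cond_mean P X A = (\<Sum>x\<in>S \<inter> A. p x *\<^sub>R x)"
  using sum_p_pos[of "S \<inter> A"] assms by (simp add: cond_mean_eq_sum)

text \<open>This is the parallel axis argument. Expanding around the mean, the cross term vanishes
  because weighted deviations sum to zero, and the remainder is the cell weight times the
  nonnegative \<open>sqnorm_wrt M d\<close>.\<close>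

lemma sum_sqnorm_cond_mean:
  assumes "A \<in> sets borel" "S \<inter> A \<noteq> {}"
  shows "(\<Sum>x\<in>S \<inter> A. p x * sqnorm_wrt M (x - cond_mean P X A))
    \<le> (\<Sum>x\<in>S \<inter> A. p x * sqnorm_wrt M (x - a))"
proof -
  let ?m = "cond_mean P X A" and ?T = "S \<inter> A"
  define d where "d = ?m - a"
  have eq: "sqnorm_wrt M (x - a)
      = sqnorm_wrt M (x - ?m) + 2 * ((M *v d) \<bullet> (x - ?m)) + sqnorm_wrt M d" for x
    using sqnorm_wrt_add[OF M, of "x - ?m" d] by (simp add: d_def)
  have "(\<Sum>x\<in>?T. p x * ((M *v d) \<bullet> (x - ?m)))
      = (M *v d) \<bullet> ((\<Sum>x\<in>?T. p x *\<^sub>R x) - (\<Sum>x\<in>?T. p x) *\<^sub>R ?m)"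
    by (simp add: inner_diff_right inner_sum_right right_diff_distrib sum_subtractf sum_distrib_right)
  also have "\<dots> = 0"
    using cond_mean_weighted[OF assms] by simp
  finally have zero: "(\<Sum>x\<in>?T. p x * ((M *v d) \<bullet> (x - ?m))) = 0" .
  have "(\<Sum>x\<in>?T. p x * sqnorm_wrt M (x - a))
      = (\<Sum>x\<in>?T. p x * sqnorm_wrt M (x - ?m)) + 2 * (\<Sum>x\<in>?T. p x * ((M *v d) \<bullet> (x - ?m)))
        + (\<Sum>x\<in>?T. p x) * sqnorm_wrt M d"
    unfolding eq by (simp add: distrib_left sum.distrib sum_distrib_left sum_distrib_right mult.left_commute)
  moreover have "0 \<le> (\<Sum>x\<in>?T. p x) * sqnorm_wrt M d"
    using sum_p_pos[of ?T] assms(2) sqnorm_wrt_nonneg[OF M] by (intro mult_nonneg_nonneg) auto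
  ultimately show ?thesis
    using zero by simp
qed

lemma two_cell_Compl: "two_cell P X A \<Longrightarrow> two_cell P X (- A)"
  by (auto simp: two_cell_iff borel_comp)

lemma cell_cost_cond_mean_le:
  assumes "two_cell P X A"
  shows "cell_cost P X M A (cond_mean P X A) (cond_mean P X (- A)) \<le> cell_cost P X M A a b"
proof -
  have A: "A \<in> sets borel" "S \<inter> A \<noteq> {}" and A': "- A \<in> sets borel" "S \<inter> - A \<noteq> {}"
    using assms two_cell_Compl[OF assms] by (auto simp: two_cell_iff)
  show ?thesis
    unfolding cell_cost_eq_sum[OF A(1)]
    using sum_sqnorm_cond_mean[OF A, of a] sum_sqnorm_cond_mean[OF A', of b]
    by (simp add: Diff_eq)
qed

lemma partition_value_eq:
  assumes "two_cell P X A"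
  shows "partition_value P X M A = cell_cost P X M A (cond_mean P X A) (cond_mean P X (- A))"
  unfolding partition_value_def
  by (rule cInf_eq_minimum) (auto intro: cell_cost_cond_mean_le[OF assms])

lemma partition_value_le:
  assumes "two_cell P X A"
  shows "partition_value P X M A \<le> cell_cost P X M A a b"
  using assms by (simp add: partition_value_eq cell_cost_cond_mean_le)

section \<open>Existence of a global minimizer\<close>

lemma two_cell_Int: "two_cell P X A \<Longrightarrow> two_cell P X (S \<inter> A)"
  using finite_S by (auto simp: two_cell_iff finite_imp_closed)

lemma partition_value_Int:
  assumes "A \<in> sets borel"
  shows "partition_value P X M (S \<inter> A) = partition_value P X M A"
proof -
  have "S \<inter> A \<in> sets borel" using finite_S by (simp add: finite_imp_closed)
  then have "cell_cost P X M (S \<inter> A) a b = cell_cost P X M A a b" for a b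
    using assms by (simp add: cell_cost_eq_sum Diff_Int)
  then show ?thesis by (simp add: partition_value_def)
qed

text \<open>Of two distinct points of \<open>S\<close>, at most one equals \<open>c\<close>. The
  nonempty remainder makes \<open>{x}\<close> an admissible cell, and the free choice of
  \<open>c\<close> serves to avoid a common mean of both cells.\<close>

lemma two_points:
  obtains x where "x \<in> S" "x \<noteq> c" "S - {x} \<noteq> {}"
proof -
  obtain y where "y \<in> S" using S_nonempty by blast
  moreover from this obtain z where "z \<in> S" "z \<noteq> y" using not_singleton[of y] by blast
  ultimately show thesis
    using that[of y] that[of z] by (cases "y = c") auto
qed

text \<open>Replacing a cell by its trace on \<open>S\<close> changes neither admissibility nor
  value, so it suffices to minimize over the finitely many admissible subsets of
  \<open>S\<close>.\<close>

lemma global_minimizer_exists: "\<exists>A. global_minimizer P X M A"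
proof -
  let ?\<T> = "{T. T \<subseteq> S \<and> two_cell P X T}"
  obtain x where "x \<in> S" "S - {x} \<noteq> {}"
    using two_points .
  then have "{x} \<in> ?\<T>" by (auto simp: two_cell_iff)
  moreover have "finite ?\<T>" using finite_S by simp
  ultimately obtain T where T: "T \<in> ?\<T>" "\<And>U. U \<in> ?\<T> \<Longrightarrow> partition_value P X M T \<le> partition_value P X M U"
    using arg_min_if_finite(1)[of ?\<T> "partition_value P X M"]
      arg_min_least[of ?\<T> _ "partition_value P X M"] by blast
  have "partition_value P X M T \<le> partition_value P X M B" if "two_cell P X B" for B
    using T(2)[of "S \<inter> B"] two_cell_Int[OF that] partition_value_Int[of B] that
    by (auto simp: two_cell_iff)
  with T(1) show ?thesis by (auto simp: global_minimizer_def)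
qed

section \<open>Signs of the bisector function and reallocation at fixed centres\<close>

lemma cond_mean_side:
  assumes "two_cell P X A" and ab: "a = cond_mean P X A" "b = cond_mean P X (- A)" "a \<noteq> b"
  shows "\<exists>x\<in>S \<inter> A. bisector_form M a b x < 0" and "\<exists>x\<in>S - A. 0 < bisector_form M a b x"
proof -
  \<comment> \<open>An affine function averaged over a cell takes its value at the cell mean. That
    value is negative at \<open>a\<close> and positive at \<open>b\<close>, so some point of each
    cell has the same strict sign.\<close>
  have avg: "(\<Sum>x\<in>S \<inter> B. p x * bisector_form M a b x) = (\<Sum>x\<in>S \<inter> B. p x) * bisector_form M a b (cond_mean P X B)"
    if "B \<in> sets borel" "S \<inter> B \<noteq> {}" for B
  proof -
    let ?v = "M *v (b - a)"
    have "(\<Sum>x\<in>S \<inter> B. p x * bisector_form M a b x)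
        = ?v \<bullet> (\<Sum>x\<in>S \<inter> B. p x *\<^sub>R x) - (\<Sum>x\<in>S \<inter> B. p x) * (?v \<bullet> ((a + b) /\<^sub>R 2))"
      unfolding bisector_form_affine
      by (simp only: right_diff_distrib sum_subtractf inner_sum_right inner_scaleR_right sum_distrib_right)
    also have "\<dots> = (\<Sum>x\<in>S \<inter> B. p x) * bisector_form M a b (cond_mean P X B)"
      unfolding cond_mean_weighted[OF that, symmetric] bisector_form_affine
      by (simp only: right_diff_distrib inner_scaleR_right)
    finally show ?thesis .
  qed
  have A: "A \<in> sets borel" "S \<inter> A \<noteq> {}" and A': "- A \<in> sets borel" "S \<inter> - A \<noteq> {}"
    using assms(1) two_cell_Compl[OF assms(1)] by (auto simp: two_cell_iff)
  have "(\<Sum>x\<in>S \<inter> A. p x * bisector_form M a b x) < 0"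
    using avg[OF A] sum_p_pos[of "S \<inter> A"] A(2) bisector_form_left[OF M ab(3)] ab(1)
    by (simp add: mult_pos_neg)
  then show "\<exists>x\<in>S \<inter> A. bisector_form M a b x < 0"
    using p_pos by (meson IntE linorder_not_le mult_nonneg_nonneg less_imp_le sum_nonneg)
  have "0 < (\<Sum>x\<in>S \<inter> - A. p x * bisector_form M a b x)"
    using avg[OF A'] sum_p_pos[of "S \<inter> - A"] A'(2) bisector_form_right[OF M ab(3)] ab(2)
    by simp
  then show "\<exists>x\<in>S - A. 0 < bisector_form M a b x"
    using p_pos unfolding Diff_eq
    by (meson IntE linorder_not_le mult_nonneg_nonpos less_imp_le sum_nonpos)
qed

lemma cell_cost_eq_sum_if:
  assumes "A \<in> sets borel"
  shows "cell_cost P X M A a b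
    = (\<Sum>x\<in>S. p x * (if x \<in> A then sqnorm_wrt M (x - a) else sqnorm_wrt M (x - b)))"
  unfolding cell_cost_eq_sum[OF assms]
  by (subst sum.Int_Diff[OF finite_S, of _ A]) simp

text \<open>With the centres fixed, points contribute independently. Moving \<open>x\<close> between
  cells changes the cost by \<open>2 * p x * bisector_form M a b x\<close> up to sign, so each
  permitted move lowers it or leaves it unchanged.\<close>

lemma cell_cost_mono:
  assumes "A \<in> sets borel" "B \<in> sets borel"
    and "\<And>x. x \<in> S \<Longrightarrow> x \<in> B \<Longrightarrow> x \<notin> A \<Longrightarrow> bisector_form M a b x \<le> 0"
    and "\<And>x. x \<in> S \<Longrightarrow> x \<notin> B \<Longrightarrow> x \<in> A \<Longrightarrow> 0 \<le> bisector_form M a b x"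
  shows "cell_cost P X M B a b \<le> cell_cost P X M A a b"
  unfolding cell_cost_eq_sum_if[OF assms(1)] cell_cost_eq_sum_if[OF assms(2)]
proof (rule sum_mono)
  fix x assume "x \<in> S"
  then show "p x * (if x \<in> B then sqnorm_wrt M (x - a) else sqnorm_wrt M (x - b))
      \<le> p x * (if x \<in> A then sqnorm_wrt M (x - a) else sqnorm_wrt M (x - b))"
    using assms(3,4)[of x] sqnorm_wrt_diff_bisector[OF M, of x a b] p_pos[of x]
    by (intro mult_left_mono) auto
qed

section \<open>Structure of an arbitrary global minimizer\<close>

context
  fixes A a b
  assumes min: "global_minimizer P X M A"
    and a: "a = cond_mean P X A" and b: "b = cond_mean P X (- A)"
begin

lemma A_cell: "two_cell P X A" and A_borel: "A \<in> sets borel"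
  using min by (auto simp: global_minimizer_def two_cell_iff)

text \<open>The centres \<open>a'\<close> and \<open>b'\<close> are arbitrary, so a competing cell
  can be tested with convenient centres instead of its own means.\<close>

lemma minimizer_cost_le: "two_cell P X B \<Longrightarrow> cell_cost P X M A a b \<le> cell_cost P X M B a' b'"
  using min partition_value_le[of B a' b'] unfolding global_minimizer_def a b
  by (fastforce simp: partition_value_eq)

lemma minimizer_means_distinct: "a \<noteq> b"
proof
  assume eq: "a = b"
  obtain x where x: "x \<in> S" "x \<noteq> a" "S - {x} \<noteq> {}"
    using two_points .
  have "two_cell P X {x}" using x by (auto simp: two_cell_iff)
  \<comment> \<open>Centred at \<open>x\<close>, the cell \<open>{x}\<close> costs nothing, while
    all other points keep the centre \<open>a\<close>. The comparison thus deletes the positive term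
    of \<open>x\<close> from the cost of \<open>A\<close>.\<close>
  from minimizer_cost_le[OF this, of x a]
  have "(\<Sum>y\<in>S. p y * sqnorm_wrt M (y - a)) \<le> (\<Sum>y\<in>S - {x}. p y * sqnorm_wrt M (y - a))"
    using x(1) by (simp add: cell_cost_eq_sum_if[OF A_borel] eq[symmetric] cell_cost_eq_sum[of "{x}"])
  moreover have "0 < p x * sqnorm_wrt M (x - a)"
    using x p_pos sqnorm_wrt_pos[OF M, of "x - a"] by simp
  ultimately show False
    using sum.remove[OF finite_S x(1), of "\<lambda>y. p y * sqnorm_wrt M (y - a)"] by simp
qed

lemma minimizer_sides:
  "\<exists>x\<in>S \<inter> A. bisector_form M a b x < 0" "\<exists>x\<in>S - A. 0 < bisector_form M a b x"
  using cond_mean_side[OF A_cell a b minimizer_means_distinct] by auto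

text \<open>The strictly negative point from \<open>minimizer_sides\<close> is forced into
  \<open>B\<close> and the strictly positive one is forced out.\<close>

lemma bisector_separated_two_cell:
  assumes "B \<in> sets borel"
    and "\<And>x. x \<in> S \<Longrightarrow> bisector_form M a b x < 0 \<Longrightarrow> x \<in> B"
    and "\<And>x. x \<in> S \<Longrightarrow> x \<in> B \<Longrightarrow> bisector_form M a b x \<le> 0"
  shows "two_cell P X B"
  using minimizer_sides assms unfolding two_cell_iff by fastforce

text \<open>At the centres of \<open>A\<close>, the cell \<open>B\<close> costs no more than
  \<open>A\<close>, whose cost there is its optimal value. Optimizing the centres for
  \<open>B\<close> can only lower its cost further.\<close>

lemma bisector_separated_minimizer:
  assumes B: "B \<in> sets borel"
    "\<And>x. x \<in> S \<Longrightarrow> bisector_form M a b x < 0 \<Longrightarrow> x \<in> B"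
    "\<And>x. x \<in> S \<Longrightarrow> x \<in> B \<Longrightarrow> bisector_form M a b x \<le> 0"
  shows "global_minimizer P X M B"
proof -
  have cell: "two_cell P X B"
    using B by (rule bisector_separated_two_cell)
  have "cell_cost P X M B a b \<le> cell_cost P X M A a b"
    using A_borel B(1)
  proof (rule cell_cost_mono)
    show "0 \<le> bisector_form M a b x" if "x \<in> S" "x \<notin> B" for x
      using B(2)[of x] that by force
  qed (use B(3) in auto)
  also have "\<dots> = partition_value P X M A"
    using A_cell by (simp add: partition_value_eq a b)
  finally have "partition_value P X M B \<le> partition_value P X M A"
    using partition_value_le[OF cell, of a b] by simp
  with min cell show ?thesis
    unfolding global_minimizer_def by (meson order_trans)
qed

text \<open>Comparing with the open bisector halfspace moves all misplaced points at once; every term of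
  the cost difference is nonnegative, so optimality forces each of them to vanish.\<close>

lemma minimizer_separated:
  assumes x: "x \<in> S"
  shows "bisector_form M a b x < 0 \<Longrightarrow> x \<in> A" and "x \<in> A \<Longrightarrow> bisector_form M a b x \<le> 0"
proof -
  let ?H = "{x. bisector_form M a b x < 0}"
  let ?f = "\<lambda>B y. p y * (if y \<in> B then sqnorm_wrt M (y - a) else sqnorm_wrt M (y - b))"
  have H: "?H \<in> sets borel" by measurable
  have le: "?f ?H y \<le> ?f A y" if "y \<in> S" for y
    using sqnorm_wrt_diff_bisector[OF M, of y a b] p_pos[OF that] by (intro mult_left_mono) auto
  have "two_cell P X ?H"
    using H by (rule bisector_separated_two_cell) auto
  from minimizer_cost_le[OF this, of a b]
  have ge: "(\<Sum>y\<in>S. ?f A y) \<le> (\<Sum>y\<in>S. ?f ?H y)"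
    unfolding cell_cost_eq_sum_if[OF A_borel] cell_cost_eq_sum_if[OF H] .
  have "(\<Sum>y\<in>S. ?f ?H y) = (\<Sum>y\<in>S. ?f A y)"
    by (rule antisym[OF sum_mono[OF le] ge])
  with x have "?f ?H x = ?f A x"
    using sum_mono_inv[of "?f ?H" S "?f A" x] le finite_S by simp
  then have "(if x \<in> ?H then sqnorm_wrt M (x - a) else sqnorm_wrt M (x - b))
      = (if x \<in> A then sqnorm_wrt M (x - a) else sqnorm_wrt M (x - b))"
    using p_pos[OF x] by simp
  then show "bisector_form M a b x < 0 \<Longrightarrow> x \<in> A" and "x \<in> A \<Longrightarrow> bisector_form M a b x \<le> 0"
    using sqnorm_wrt_diff_bisector[OF M, of x a b] by (auto split: if_splits)
qed

end

end

theorem proposition7p1: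
  fixes P :: "'w measure" and X :: "'w \<Rightarrow> real^'n" and M :: "real^'n^'n"
  assumes "prob_space P"
    and "X \<in> borel_measurable P"
    and "sym_pos_def M"
    and "finite (law_support P X)"
    and "\<not> (\<exists>c. law_support P X = {c})"
  shows
    "(\<forall>A. two_cell P X A \<longrightarrow>
        (\<exists>a b. cell_cost P X M A a b = partition_value P X M A
             \<and> (\<forall>a' b'. cell_cost P X M A a b \<le> cell_cost P X M A a' b')))
     \<and> (\<exists>H. global_minimizer P X M H \<and> affine_halfspace H)
     \<and> (\<forall>A a b. global_minimizer P X M A \<and> a = cond_mean P X A \<and> b = cond_mean P X (- A) \<longrightarrow>
          a \<noteq> b
        \<and> law_subset P X {x. bisector_form M a b x < 0} A
        \<and> law_subset P X A {x. bisector_form M a b x \<le> 0}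
        \<and> (\<P>(\<omega> in P. bisector_form M a b (X \<omega>) = 0) = 0 \<longrightarrow>
             (\<exists>H. halfspace_with_normal (M *v (b - a)) H \<and> law_equal P X A H))
        \<and> (\<forall>B \<in> sets borel.
             law_subset P X {x. bisector_form M a b x < 0} B \<and>
             law_subset P X B {x. bisector_form M a b x \<le> 0} \<longrightarrow>
             global_minimizer P X M B)
        \<and> (\<forall>H \<in> {{x. bisector_form M a b x < 0}, {x. bisector_form M a b x \<le> 0}}.
             global_minimizer P X M H \<and> halfspace_with_normal (M *v (b - a)) H))"
proof -
  interpret prob_space P by fact
  \<comment> \<open>The role of \<open>S\<close> is played by the topological support, which carries
    the law and, being finite, consists of atoms.\<close>
  interpret finitely_supported_vector P X M "law_support P X" "\<lambda>x. prob {\<omega> \<in> space P. X \<omega> = x}"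
    using assms AE_in_law_support finite_law_support_atom by unfold_locales auto
  let ?S = "law_support P X"
  have cond: "\<exists>a b. cell_cost P X M A a b = partition_value P X M A
      \<and> (\<forall>a' b'. cell_cost P X M A a b \<le> cell_cost P X M A a' b')" if "two_cell P X A" for A
    using partition_value_eq[OF that] cell_cost_cond_mean_le[OF that] by metis
  have half: "global_minimizer P X M H \<and> halfspace_with_normal (M *v (b - a)) H"
    if "global_minimizer P X M A" "a = cond_mean P X A" "b = cond_mean P X (- A)"
      "H \<in> {{x. bisector_form M a b x < 0}, {x. bisector_form M a b x \<le> 0}}" for A a b H
  proof
    show "halfspace_with_normal (M *v (b - a)) H"
      using bisector_sublevel_halfspace[OF assms(3) minimizer_means_distinct[OF that(1-3)]] that(4)
      by auto
    have "{x. bisector_form M a b x < 0} \<in> sets borel" "{x. bisector_form M a b x \<le> 0} \<in> sets borel"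
      by measurable
    then show "global_minimizer P X M H"
      using that(4) by (intro bisector_separated_minimizer[OF that(1-3)]) auto
  qed
  have ex: "\<exists>H. global_minimizer P X M H \<and> affine_halfspace H"
    \<comment> \<open>The witness is the open bisector halfspace of any global minimizer.\<close>
    using global_minimizer_exists half unfolding affine_halfspace_def by (metis insertI1)
  have equal: "\<exists>H. halfspace_with_normal (M *v (b - a)) H \<and> law_equal P X A H"
    if "global_minimizer P X M A" "a = cond_mean P X A" "b = cond_mean P X (- A)"
      "\<P>(\<omega> in P. bisector_form M a b (X \<omega>) = 0) = 0" for A a b
  proof -
    have [measurable]: "{x. bisector_form M a b x = 0} \<in> sets borel" by measurable
    have "(\<Sum>x\<in>?S \<inter> {x. bisector_form M a b x = 0}. prob {\<omega> \<in> space P. X \<omega> = x}) = 0"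
      using that(4) prob_eq_sum[of "{x. bisector_form M a b x = 0}"] by simp
    \<comment> \<open>All atom weights are positive, so a bisector of probability zero contains no
      support point. Both bisector halfspaces then have the same trace on the support as
      \<open>A\<close>.\<close>
    then have "bisector_form M a b x \<noteq> 0" if "x \<in> ?S" for x
      using that sum_p_pos[of "?S \<inter> {x. bisector_form M a b x = 0}"] by auto
    then have "law_equal P X A {x. bisector_form M a b x \<le> 0}"
      using minimizer_separated[OF that(1-3)] unfolding law_equal_def law_subset_iff
      by (auto simp: less_le)
    with half[OF that(1-3)] show ?thesis by blast
  qed
  have sep: "law_subset P X {x. bisector_form M a b x < 0} A \<and> law_subset P X A {x. bisector_form M a b x \<le> 0}"
    if "global_minimizer P X M A" "a = cond_mean P X A" "b = cond_mean P X (- A)" for A a b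
    using minimizer_separated[OF that] unfolding law_subset_iff by blast
  have reallocate: "global_minimizer P X M B"
    if "global_minimizer P X M A" "a = cond_mean P X A" "b = cond_mean P X (- A)" "B \<in> sets borel"
      "law_subset P X {x. bisector_form M a b x < 0} B" "law_subset P X B {x. bisector_form M a b x \<le> 0}"
    for A B a b
    using that(5,6) unfolding law_subset_iff
    by (intro bisector_separated_minimizer[OF that(1-4)]) auto
  show ?thesis
    by (intro conjI allI impI ballI; (elim conjE)?;
        (rule cond ex minimizer_means_distinct equal sep[THEN conjunct1] sep[THEN conjunct2]
          reallocate half[THEN conjunct1] half[THEN conjunct2]; assumption))
qed

end
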